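(* Let $n\ge 2$ and $1\le s\le n$ be integers, let $r_1,\dots,r_s$ be positive integers with $r_1+\dots+r_s=n$, and let $1\le s'\le s$. Let $\mathbb E_E\subset\mathbb C^N$ be the generalized tetrablock associated with $(r_1,\dots,r_s)$ and $\mathbb E_{E'}\subset\mathbb C^{N'}$ the one associated with $(r_1,\dots,r_{s'})$; put $N''=N-N'$ and write $x=(x',x'')\in\mathbb C^{N'}\times\mathbb C^{N''}$ for $x\in\mathbb C^N$. Then the mappings $$\mathbb E_{E'}\ni x'\overset{\theta}\longmapsto(x',0)\in\mathbb E_E,\qquad \mathbb E_E\ni(x',x'')\overset{\iota}\longmapsto x'\in\mathbb E_{E'}$$ are well defined. In particular, $\mathbb E_{E'}$ is an analytic retract of $\mathbb E_E$. Moreover, $\mathbb E_E$ is a Hartogs domain over $\mathbb E_{E'}$ with $N''$-dimensional $m$-balanced fibers, where $$m=\Big(\underbrace{|\alpha^{N'+1}|,\dots,|\alpha^{N'+1}|}_{(N'+1)\times},\dots,\underbrace{|\alpha^{M(N'+1)}|,\dots,|\alpha^{M(N'+1)}|}_{(N'+1)\times}\Big)\in\mathbb Z^{N''},\qquad M=\prod_{j=s'+1}^s(r_j+1)-1$$ (the $k$-th block, $k=1,\dots,M$, consists of $N'+1$ copies of $|\alpha^{k(N'+1)}|$).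
   Context: Let $A(r_1,\dots,r_s)=\{0,\dots,r_1\}\times\dots\times\{0,\dots,r_s\}\setminus\{(0,\dots,0)\}$, totally ordered by: for $\alpha\ne\beta$, $\alpha<\beta$ iff $\alpha_{j_0}<\beta_{j_0}$ where $j_0=\max\{j:\alpha_j\ne\beta_j\}$. Write $A(r_1,\dots,r_s)=\{\alpha^1<\dots<\alpha^N\}$, $N=\prod_{j=1}^s(r_j+1)-1$. For $x\in\mathbb C^N$, $z\in\mathbb C^s$ put $R_x(z)=1+\sum_{j=1}^N(-1)^{|\alpha^j|}x_jz^{\alpha^j}$, where $|\alpha|=\alpha_1+\dots+\alpha_s$, $z^\alpha=z_1^{\alpha_1}\cdots z_s^{\alpha_s}$. With $\mathbb D$ the open unit disc, the generalized tetrablock is $\mathbb E_E=\{x\in\mathbb C^N: R_x(z)\neq 0\text{ for all }z\in\overline{\mathbb D}^s\}$ (here $E$ refers to the space of matrices $\operatorname{diag}[z_1\mathbb I_{r_1},\dots,z_s\mathbb I_{r_s}]$). Put $N'=\prod_{j=1}^{s'}(r_j+1)-1$. The first $N'$ multi-indices $\alpha^1,\dots,\alpha^{N'}$ are exactly those elements of $A(r_1,\dots,r_s)$ whose coordinates with index $>s'$ all vanish; put $(\alpha^j)'=(\alpha^j_1,\dots,\alpha^j_{s'})$. For $x'\in\mathbb C^{N'}$ let $R'_{x'}(z')=1+\sum_{j=1}^{N'}(-1)^{|(\alpha^j)'|}x_j(z')^{(\alpha^j)'}$, $z'\in\mathbb C^{s'}$, and $\mathbb E_{E'}=\{x'\in\mathbb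 C^{N'}:R'_{x'}(z')\ne0\text{ for all }z'\in\overline{\mathbb D}^{s'}\}$. (If $s'=s$, then $N''=0$, $M=0$ and the statement is trivial.) A domain $G$ is an analytic retract of a domain $D$ if there exist holomorphic maps $\theta:G\to D$, $\iota:D\to G$ with $\iota\circ\theta=\operatorname{id}_G$. For $m=(m_1,\dots,m_k)$ and $\lambda\in\mathbb C$ let $m_\lambda.z=(\lambda^{m_1}z_1,\dots,\lambda^{m_k}z_k)$, $z\in\mathbb C^k$; a set $B\subset\mathbb C^k$ is $m$-balanced if $m_\lambda.z\in B$ whenever $z\in B$, $\lambda\in\overline{\mathbb D}$. That $\mathbb E_E$ is a Hartogs domain over $\mathbb E_{E'}$ with $N''$-dimensional $m$-balanced fibers means: $\mathbb E_E\cap(\mathbb C^{N'}\times\{0\}^{N''})=\mathbb E_{E'}\times\{0\}^{N''}$, the projection of $\mathbb E_E$ to $\mathbb C^{N'}$ is $\mathbb E_{E'}$, and for every $x'\in\mathbb E_{E'}$ the fiber $\{x''\in\mathbb C^{N''}:(x',x'')\in\mathbb E_E\}$ is $m$-balanced. *)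

theory Defs
  imports "HOL-Analysis.Analysis"
begin

(* All vectors are indexed from 1.  As in HOL-Analysis.Abstract_Euclidean_Space, C^k is the set of
   sequences that vanish off {1..k}; it carries the subspace topology of the product topology.
   With this encoding C^k is a subset of C^l for k <= l. *)
definition cspace :: "nat \<Rightarrow> (nat \<Rightarrow> complex) set" where
  "cspace k = {x. \<forall>i. i \<notin> {1..k} \<longrightarrow> x i = 0}"

definition cjoin :: "nat \<Rightarrow> (nat \<Rightarrow> complex) \<Rightarrow> (nat \<Rightarrow> complex) \<Rightarrow> nat \<Rightarrow> complex" where
  "cjoin k x' x'' = (\<lambda>i. if i \<le> k then x' i else x'' (i - k))"

definition chead :: "nat \<Rightarrow> (nat \<Rightarrow> complex) \<Rightarrow> nat \<Rightarrow> complex" where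
  "chead k x = (\<lambda>i. if i \<le> k then x i else 0)"

definition closed_polydisc :: "nat \<Rightarrow> (nat \<Rightarrow> complex) set" where
  "closed_polydisc k = {z \<in> cspace k. \<forall>i\<in>{1..k}. norm (z i) \<le> 1}"

definition cdomain :: "nat \<Rightarrow> (nat \<Rightarrow> complex) set \<Rightarrow> bool" where
  "cdomain k D \<longleftrightarrow> openin (top_of_set (cspace k)) D \<and> connected D \<and> D \<noteq> {}"

(* Complex (Frechet) differentiability on D, meant for D open in C^k; the derivative is the
   complex linear form h |-> sum_i a_i h_i. *)
definition cholomorphic :: "nat \<Rightarrow> (nat \<Rightarrow> complex) set \<Rightarrow> ((nat \<Rightarrow> complex) \<Rightarrow> complex) \<Rightarrow> bool" where
  "cholomorphic k D f \<longleftrightarrow>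
     (\<forall>x\<in>D. \<exists>a :: nat \<Rightarrow> complex.
        ((\<lambda>y. (f y - f x - (\<Sum>i=1..k. a i * (y i - x i))) /
              complex_of_real (L2_set (\<lambda>i. norm (y i - x i)) {1..k})) \<longlongrightarrow> 0) (at x within D))"

definition cholomorphic_map ::
  "nat \<Rightarrow> (nat \<Rightarrow> complex) set \<Rightarrow> nat \<Rightarrow> (nat \<Rightarrow> complex) set \<Rightarrow>
   ((nat \<Rightarrow> complex) \<Rightarrow> nat \<Rightarrow> complex) \<Rightarrow> bool" where
  "cholomorphic_map k D l G F \<longleftrightarrow>
     F \<in> D \<rightarrow> G \<and> (\<forall>i\<in>{1..l}. cholomorphic k D (\<lambda>x. F x i))"

(* The domain G in C^l is an analytic retract of the domain D in C^k. *)
definition analytic_retract ::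
  "nat \<Rightarrow> (nat \<Rightarrow> complex) set \<Rightarrow> nat \<Rightarrow> (nat \<Rightarrow> complex) set \<Rightarrow> bool" where
  "analytic_retract l G k D \<longleftrightarrow>
     cdomain l G \<and> cdomain k D \<and>
     (\<exists>\<theta> \<iota>. cholomorphic_map l G k D \<theta> \<and> cholomorphic_map k D l G \<iota> \<and>
        (\<forall>x\<in>G. \<iota> (\<theta> x) = x))"

definition m_dilation :: "nat list \<Rightarrow> complex \<Rightarrow> (nat \<Rightarrow> complex) \<Rightarrow> nat \<Rightarrow> complex" where
  "m_dilation m c z = (\<lambda>i. if i \<in> {1..length m} then c ^ (m ! (i - 1)) * z i else 0)"

definition m_balanced :: "nat \<Rightarrow> nat list \<Rightarrow> (nat \<Rightarrow> complex) set \<Rightarrow> bool" where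
  "m_balanced k m B \<longleftrightarrow>
     length m = k \<and> B \<subseteq> cspace k \<and> (\<forall>z\<in>B. \<forall>c. norm c \<le> 1 \<longrightarrow> m_dilation m c z \<in> B)"

(* D in C^(k+l) is a Hartogs domain over G in C^k with l-dimensional m-balanced fibers. *)
definition hartogs_over ::
  "nat \<Rightarrow> nat \<Rightarrow> nat list \<Rightarrow> (nat \<Rightarrow> complex) set \<Rightarrow> (nat \<Rightarrow> complex) set \<Rightarrow> bool" where
  "hartogs_over k l m D G \<longleftrightarrow>
     D \<inter> {cjoin k x' (\<lambda>_. 0) |x'. x' \<in> cspace k} = {cjoin k x' (\<lambda>_. 0) |x'. x' \<in> G} \<and>
     chead k ` D = G \<and>
     (\<forall>x'\<in>G. m_balanced l m {x'' \<in> cspace l. cjoin k x' x'' \<in> D})"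

(* A(r_1,...,r_s); multi-indices are extended by 0 off {1..s}. *)
definition multi_indices :: "(nat \<Rightarrow> nat) \<Rightarrow> nat \<Rightarrow> (nat \<Rightarrow> nat) set" where
  "multi_indices r s =
     {\<alpha>. (\<forall>j\<in>{1..s}. \<alpha> j \<le> r j) \<and> (\<forall>j. j \<notin> {1..s} \<longrightarrow> \<alpha> j = 0)} - {\<lambda>_. 0}"

definition mi_less :: "(nat \<Rightarrow> nat) \<Rightarrow> (nat \<Rightarrow> nat) \<Rightarrow> bool" where
  "mi_less \<alpha> \<beta> \<longleftrightarrow>
     \<alpha> \<noteq> \<beta> \<and> (let j0 = Max {j. \<alpha> j \<noteq> \<beta> j} in \<alpha> j0 < \<beta> j0)"

definition mi_dim :: "(nat \<Rightarrow> nat) \<Rightarrow> nat \<Rightarrow> nat" where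
  "mi_dim r s = (\<Prod>j=1..s. r j + 1) - 1"

(* The j-th element alpha^j of A(r_1,...,r_s), for 1 <= j <= mi_dim r s. *)
definition mi_nth :: "(nat \<Rightarrow> nat) \<Rightarrow> nat \<Rightarrow> nat \<Rightarrow> nat \<Rightarrow> nat" where
  "mi_nth r s j =
     (THE \<alpha>. \<alpha> \<in> multi_indices r s \<and> card {\<beta> \<in> multi_indices r s. mi_less \<beta> \<alpha>} + 1 = j)"

definition mi_abs :: "nat \<Rightarrow> (nat \<Rightarrow> nat) \<Rightarrow> nat" where
  "mi_abs s \<alpha> = (\<Sum>j=1..s. \<alpha> j)"

definition tetra_poly :: "(nat \<Rightarrow> nat) \<Rightarrow> nat \<Rightarrow> (nat \<Rightarrow> complex) \<Rightarrow> (nat \<Rightarrow> complex) \<Rightarrow> complex" where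
  "tetra_poly r s x z =
     1 + (\<Sum>j=1..mi_dim r s.
            (-1) ^ mi_abs s (mi_nth r s j) * x j * (\<Prod>i=1..s. z i ^ mi_nth r s j i))"

definition gen_tetrablock :: "(nat \<Rightarrow> nat) \<Rightarrow> nat \<Rightarrow> (nat \<Rightarrow> complex) set" where
  "gen_tetrablock r s =
     {x \<in> cspace (mi_dim r s). \<forall>z\<in>closed_polydisc s. tetra_poly r s x z \<noteq> 0}"


(* mi_nth is the increasing enumeration of the multi-indices, and the one for (r_1,...,r_s')
   is an initial segment of the one for (r_1,...,r_s). *)

lemma finite_diff_mi:
  assumes "\<alpha> \<in> multi_indices r s" "\<beta> \<in> multi_indices r s"
  shows "finite {j. \<alpha> j \<noteq> \<beta> j}"
proof (rule finite_subset)
  show "{j. \<alpha> j \<noteq> \<beta> j} \<subseteq> {1..s}"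
    using assms unfolding multi_indices_def by force
qed simp

lemma mi_less_iff:
  assumes "finite {j. \<alpha> j \<noteq> \<beta> j}"
  shows "mi_less \<alpha> \<beta> \<longleftrightarrow> (\<exists>k. \<alpha> k < \<beta> k \<and> (\<forall>j>k. \<alpha> j = \<beta> j))"
proof
  assume L: "mi_less \<alpha> \<beta>"
  let ?k = "Max {j. \<alpha> j \<noteq> \<beta> j}"
  have "\<forall>j>?k. \<alpha> j = \<beta> j"
    using Max_ge[OF assms] by (metis (mono_tags, lifting) leD mem_Collect_eq)
  with L show "\<exists>k. \<alpha> k < \<beta> k \<and> (\<forall>j>k. \<alpha> j = \<beta> j)"
    unfolding mi_less_def Let_def by blast
next
  assume "\<exists>k. \<alpha> k < \<beta> k \<and> (\<forall>j>k. \<alpha> j = \<beta> j)"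
  then obtain k where k: "\<alpha> k < \<beta> k" "\<forall>j>k. \<alpha> j = \<beta> j" by blast
  have "Max {j. \<alpha> j \<noteq> \<beta> j} = k"
    by (rule Max_eqI[OF assms]) (use k in \<open>auto simp: not_less[symmetric]\<close>)
  with k show "mi_less \<alpha> \<beta>"
    unfolding mi_less_def Let_def by auto
qed

lemma mi_less_linear:
  assumes "\<alpha> \<in> multi_indices r s" "\<beta> \<in> multi_indices r s" "\<alpha> \<noteq> \<beta>"
  shows "mi_less \<alpha> \<beta> \<or> mi_less \<beta> \<alpha>"
proof -
  have "{j. \<alpha> j \<noteq> \<beta> j} \<noteq> {}" using assms(3) by auto
  then have "\<alpha> (Max {j. \<alpha> j \<noteq> \<beta> j}) \<noteq> \<beta> (Max {j. \<alpha> j \<noteq> \<beta> j})"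
    using Max_in[OF finite_diff_mi[OF assms(1,2)]] by auto
  moreover have "{j. \<alpha> j \<noteq> \<beta> j} = {j. \<beta> j \<noteq> \<alpha> j}" by auto
  ultimately show ?thesis
    using assms(3) unfolding mi_less_def Let_def by (metis nat_neq_iff)
qed

lemma mi_less_trans:
  assumes "\<alpha> \<in> multi_indices r s" "\<beta> \<in> multi_indices r s" "\<gamma> \<in> multi_indices r s"
    and "mi_less \<alpha> \<beta>" "mi_less \<beta> \<gamma>"
  shows "mi_less \<alpha> \<gamma>"
proof -
  obtain k where k: "\<alpha> k < \<beta> k" "\<forall>j>k. \<alpha> j = \<beta> j"
    using assms mi_less_iff[OF finite_diff_mi] by metis
  obtain l where l: "\<beta> l < \<gamma> l" "\<forall>j>l. \<beta> j = \<gamma> j"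
    using assms mi_less_iff[OF finite_diff_mi] by metis
  have "\<alpha> (max k l) < \<gamma> (max k l) \<and> (\<forall>j>max k l. \<alpha> j = \<gamma> j)"
    using k l by (cases k l rule: linorder_cases) auto
  then show ?thesis
    using assms mi_less_iff[OF finite_diff_mi] by metis
qed

lemma mi_less_irrefl: "\<not> mi_less \<alpha> \<alpha>"
  by (simp add: mi_less_def)

lemma finite_multi_indices: "finite (multi_indices r s)"
  and card_multi_indices: "card (multi_indices r s) = mi_dim r s"
proof -
  let ?P = "PiE {1..s} (\<lambda>j. {0..r j})"
  let ?B = "{\<alpha>. (\<forall>j\<in>{1..s}. \<alpha> j \<le> r j) \<and> (\<forall>j. j \<notin> {1..s} \<longrightarrow> \<alpha> j = 0)}"
  have "bij_betw (\<lambda>\<alpha> j. if j \<in> {1..s} then \<alpha> j else 0) ?P ?B"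
    by (rule bij_betw_byWitness[where f' = "\<lambda>\<alpha>. restrict \<alpha> {1..s}"])
       (auto simp: PiE_def Pi_def extensional_def fun_eq_iff split: if_splits)
  then have *: "finite ?B" "card ?B = card ?P"
    using bij_betw_finite finite_PiE[of "{1..s}" "\<lambda>j. {0..r j}"] by (auto simp: bij_betw_same_card)
  show "finite (multi_indices r s)"
    unfolding multi_indices_def using * by auto
  have "card ?P = (\<Prod>j=1..s. r j + 1)"
    by (subst card_PiE) auto
  then show "card (multi_indices r s) = mi_dim r s"
    unfolding multi_indices_def mi_dim_def using * by (subst card_Diff_singleton) auto
qed

lemma mi_rank_strict_mono:
  assumes "\<alpha> \<in> multi_indices r s" "\<beta> \<in> multi_indices r s" "mi_less \<alpha> \<beta>"
  shows "card {\<gamma> \<in> multi_indices r s. mi_less \<gamma> \<alpha>} < card {\<gamma> \<in> multi_indices r s. mi_less \<gamma> \<beta>}"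
proof (rule psubset_card_mono)
  show "finite {\<gamma> \<in> multi_indices r s. mi_less \<gamma> \<beta>}"
    using finite_multi_indices by simp
  show "{\<gamma> \<in> multi_indices r s. mi_less \<gamma> \<alpha>} \<subset> {\<gamma> \<in> multi_indices r s. mi_less \<gamma> \<beta>}"
    using assms mi_less_trans mi_less_irrefl by blast
qed

lemma bij_betw_mi_rank:
  "bij_betw (\<lambda>\<alpha>. card {\<beta> \<in> multi_indices r s. mi_less \<beta> \<alpha>} + 1)
     (multi_indices r s) {1..mi_dim r s}"
proof -
  let ?A = "multi_indices r s"
  let ?f = "\<lambda>\<alpha>. card {\<beta> \<in> ?A. mi_less \<beta> \<alpha>} + 1"
  have inj: "inj_on ?f ?A"
  proof (rule inj_onI)
    fix \<alpha> \<beta> assume a: "\<alpha> \<in> ?A" "\<beta> \<in> ?A" "?f \<alpha> = ?f \<beta>"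
    show "\<alpha> = \<beta>"
      using mi_less_linear[OF a(1,2)] mi_rank_strict_mono[OF a(1,2)]
        mi_rank_strict_mono[OF a(2,1)] a(3) by force
  qed
  have "?f ` ?A \<subseteq> {1..mi_dim r s}"
  proof
    fix k assume "k \<in> ?f ` ?A"
    then obtain \<alpha> where a: "\<alpha> \<in> ?A" "k = ?f \<alpha>" by auto
    have "card {\<beta> \<in> ?A. mi_less \<beta> \<alpha>} < card ?A"
      by (rule psubset_card_mono[OF finite_multi_indices]) (use a mi_less_irrefl in blast)
    with a show "k \<in> {1..mi_dim r s}" by (simp add: card_multi_indices)
  qed
  moreover have "card (?f ` ?A) = card {1..mi_dim r s}"
    using card_image[OF inj] by (simp add: card_multi_indices)
  ultimately have "?f ` ?A = {1..mi_dim r s}"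
    by (rule card_subset_eq[OF finite_atLeastAtMost])
  with inj show ?thesis unfolding bij_betw_def by (rule conjI)
qed

lemma mi_nth_eq:
  assumes "\<alpha> \<in> multi_indices r s" "card {\<beta> \<in> multi_indices r s. mi_less \<beta> \<alpha>} + 1 = j"
  shows "mi_nth r s j = \<alpha>"
  unfolding mi_nth_def
proof (rule the_equality)
  fix \<gamma> assume "\<gamma> \<in> multi_indices r s \<and> card {\<beta> \<in> multi_indices r s. mi_less \<beta> \<gamma>} + 1 = j"
  then have "\<gamma> \<in> multi_indices r s"
    and "card {\<beta> \<in> multi_indices r s. mi_less \<beta> \<gamma>} + 1 =
         card {\<beta> \<in> multi_indices r s. mi_less \<beta> \<alpha>} + 1"
    unfolding assms(2) by blast+
  then show "\<gamma> = \<alpha>"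
    using inj_onD[OF bij_betw_imp_inj_on[OF bij_betw_mi_rank[of r s]] _ _ assms(1)] by blast
qed (intro conjI assms)

lemma ex_mi_rank:
  assumes "j \<in> {1..mi_dim r s}"
  shows "\<exists>\<alpha>\<in>multi_indices r s. card {\<beta> \<in> multi_indices r s. mi_less \<beta> \<alpha>} + 1 = j"
proof -
  have "j \<in> (\<lambda>\<alpha>. card {\<beta> \<in> multi_indices r s. mi_less \<beta> \<alpha>} + 1) ` multi_indices r s"
    unfolding bij_betw_imp_surj_on[OF bij_betw_mi_rank] by (rule assms)
  then show ?thesis
    by (elim imageE) (rule bexI, rule sym)
qed

lemma bij_betw_mi_nth: "bij_betw (mi_nth r s) {1..mi_dim r s} (multi_indices r s)"
proof -
  let ?f = "\<lambda>\<alpha>. card {\<beta> \<in> multi_indices r s. mi_less \<beta> \<alpha>} + 1"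
  have "?f ` multi_indices r s = {1..mi_dim r s}"
    using bij_betw_imp_surj_on[OF bij_betw_mi_rank[of r s]] .
  moreover have "mi_nth r s j \<in> multi_indices r s \<and> ?f (mi_nth r s j) = j"
    if j: "j \<in> {1..mi_dim r s}" for j
  proof -
    obtain \<alpha> where a: "\<alpha> \<in> multi_indices r s" "?f \<alpha> = j"
      using ex_mi_rank[OF j] by (elim bexE)
    show ?thesis
      unfolding mi_nth_eq[OF a] using a by (intro conjI)
  qed
  moreover have "mi_nth r s (?f \<alpha>) = \<alpha>" if "\<alpha> \<in> multi_indices r s" for \<alpha>
    by (rule mi_nth_eq[OF that refl])
  ultimately show ?thesis
    by (intro bij_betw_byWitness[where f' = ?f] ballI image_subsetI) blast+
qed

lemma mi_nth_strict_mono: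
  assumes "i \<in> {1..mi_dim r s}" "j \<in> {1..mi_dim r s}" "i < j"
  shows "mi_less (mi_nth r s i) (mi_nth r s j)"
proof -
  obtain \<alpha> where a: "\<alpha> \<in> multi_indices r s" "card {\<beta> \<in> multi_indices r s. mi_less \<beta> \<alpha>} + 1 = i"
    using ex_mi_rank[OF assms(1)] by (elim bexE)
  obtain \<gamma> where c: "\<gamma> \<in> multi_indices r s" "card {\<beta> \<in> multi_indices r s. mi_less \<beta> \<gamma>} + 1 = j"
    using ex_mi_rank[OF assms(2)] by (elim bexE)
  have "\<not> mi_less \<gamma> \<alpha>"
    using mi_rank_strict_mono[OF c(1) a(1)] a(2) c(2) assms(3) by linarith
  moreover have "\<alpha> \<noteq> \<gamma>"
    using a(2) c(2) assms(3) by blast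
  ultimately show ?thesis
    using mi_less_linear[OF a(1) c(1)] unfolding mi_nth_eq[OF a] mi_nth_eq[OF c] by blast
qed

lemma mi_nth_initial_segment:
  assumes "s' \<le> s" "j \<in> {1..mi_dim r s'}"
  shows "mi_nth r s j = mi_nth r s' j"
proof -
  have sub: "multi_indices r s' \<subseteq> multi_indices r s"
  proof
    fix \<beta> assume b: "\<beta> \<in> multi_indices r s'"
    have "\<beta> j \<le> r j" if "j \<in> {1..s}" for j
      using b that unfolding multi_indices_def by (cases "j \<in> {1..s'}") auto
    moreover have "\<beta> j = 0" if "j \<notin> {1..s}" for j
    proof -
      have "j \<notin> {1..s'}" using that assms(1) by auto
      with b show ?thesis unfolding multi_indices_def by blast
    qed
    ultimately show "\<beta> \<in> multi_indices r s"
      using b unfolding multi_indices_def by blast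
  qed
  obtain \<alpha> where a: "\<alpha> \<in> multi_indices r s'"
      "card {\<beta> \<in> multi_indices r s'. mi_less \<beta> \<alpha>} + 1 = j"
    using ex_mi_rank[OF assms(2)] by (elim bexE)
  have "\<beta> \<in> multi_indices r s'" if b: "\<beta> \<in> multi_indices r s" "mi_less \<beta> \<alpha>" for \<beta>
  proof -
    obtain k where k: "\<beta> k < \<alpha> k" "\<forall>j>k. \<beta> j = \<alpha> j"
      using b a sub mi_less_iff[OF finite_diff_mi] by (metis subsetD)
    have az: "\<alpha> i = 0" if "i > s'" for i
      using a(1) that unfolding multi_indices_def by auto
    have "k \<le> s'" using k(1) az[of k] by (cases "k \<le> s'") auto
    then have "\<beta> i = 0" if "i > s'" for i using k(2) az that by auto
    moreover have "\<beta> i = 0" if "i = 0" for i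
      using b(1) that unfolding multi_indices_def by auto
    ultimately have "\<beta> i = 0" if "i \<notin> {1..s'}" for i
      using that by (cases "i = 0") auto
    moreover have "\<beta> i \<le> r i" if "i \<in> {1..s'}" for i
      using b(1) that assms(1) unfolding multi_indices_def by auto
    ultimately show ?thesis
      using b(1) unfolding multi_indices_def by blast
  qed
  then have "{\<beta> \<in> multi_indices r s. mi_less \<beta> \<alpha>} = {\<beta> \<in> multi_indices r s'. mi_less \<beta> \<alpha>}"
    using sub by blast
  then have "card {\<beta> \<in> multi_indices r s. mi_less \<beta> \<alpha>} + 1 = j"
    using a(2) by (simp only:)
  then have "mi_nth r s j = \<alpha>"
    using mi_nth_eq a(1) sub by blast
  with mi_nth_eq[OF a] show ?thesis by (simp only:)
qed

end

theory Submission
  imports Defs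
begin

text \<open>
  Everything rests on one identity. Scaling only the variables \<open>z\<^sub>i\<close> with \<open>i > t\<close> by \<open>c\<close> multiplies the
  monomial \<open>z\<^sup>\<alpha>\<close> by \<open>c\<close> to the power \<open>\<Sum>\<^sub>i\<^sub>>\<^sub>t \<alpha>\<^sub>i\<close>, the tail degree of \<open>\<alpha>\<close>. So multiplying each coordinate
  \<open>x\<^sub>j\<close> by \<open>c\<close> to the tail degree of \<open>\<alpha>\<^sup>j\<close> (the tail dilation of \<open>x\<close>) has the same effect
  as evaluating \<open>R\<^sub>x\<close> at the scaled \<open>z\<close>. For \<open>|c| \<le> 1\<close> the scaled point stays in the closed polydisc;
  hence the tetrablock is invariant under every tail dilation (\<open>tail_dilation_in_gen_tetrablock\<close>).

  Three cases of this invariance give the theorem.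

  For \<open>t = s'\<close> and \<open>c = 0\<close>, a coordinate survives exactly if its tail degree vanishes, that is, if it
  is one of the first \<open>N'\<close>. The dilation is therefore the projection \<open>x \<mapsto> x'\<close>, and the big tetrablock
  contains \<open>(x', 0)\<close> with each of its points \<open>(x', x'')\<close>. In this encoding \<open>(x', 0)\<close> and \<open>x'\<close> are the
  same sequence, and the small tetrablock is the slice of the big one by the first \<open>N'\<close>
  coordinates (\<open>gen_tetrablock_slice\<close>). This yields the two maps and the retraction.

  For \<open>t = s'\<close> and general \<open>c\<close>, the dilation fixes \<open>x'\<close> and acts on \<open>x''\<close> by the weights \<open>m\<close>, so the
  fibers are \<open>m\<close>-balanced. To identify the weights, read a multi-index as the digits of a number in
  the mixed radix system with digit bounds \<open>r\<^sub>1, r\<^sub>2, \<dots>\<close>; since the last coordinate is the most significant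
  one for the given order, \<open>\<alpha>\<^sup>j\<close> is the digit expansion of \<open>j\<close> (\<open>mi_value_mi_nth\<close>). Clearing the first
  \<open>s'\<close> digits of \<open>j\<close> rounds it down to a multiple \<open>k (N' + 1)\<close>, whence the tail degree of \<open>\<alpha>\<^sup>j\<close> is
  \<open>|\<alpha>\<^bsup>k(N'+1)\<^esup>|\<close>.

  For \<open>t = 0\<close> and real \<open>c\<close> between \<open>1\<close> and \<open>0\<close>, the dilations join every point to the origin, so the
  tetrablock is connected. It is open because the closed polydisc is compact.
\<close>

section \<open>The enumeration of multi-indices as mixed radix expansion\<close>

definition mi_place_value :: "(nat \<Rightarrow> nat) \<Rightarrow> nat \<Rightarrow> nat" where
  "mi_place_value r i = (\<Prod>k=1..<i. r k + 1)"

definition mi_value :: "(nat \<Rightarrow> nat) \<Rightarrow> nat \<Rightarrow> (nat \<Rightarrow> nat) \<Rightarrow> nat" where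
  "mi_value r s \<alpha> = (\<Sum>i=1..s. \<alpha> i * mi_place_value r i)"

lemma mi_place_value_pos: "mi_place_value r i > 0"
  by (simp add: mi_place_value_def prod_pos)

lemma mi_place_value_Suc: "mi_place_value r (Suc (Suc t)) = mi_place_value r (Suc t) * (r (Suc t) + 1)"
  by (simp add: mi_place_value_def)

lemma Suc_mi_dim: "Suc (mi_dim r t) = mi_place_value r (Suc t)"
proof -
  have "(\<Prod>j=1..t. r j + 1) > 0" by (simp add: prod_pos)
  then show ?thesis
    by (simp add: mi_dim_def mi_place_value_def atLeastLessThanSuc_atLeastAtMost)
qed

lemma mi_place_value_dvd: "i \<le> k \<Longrightarrow> mi_place_value r i dvd mi_place_value r k"
  unfolding mi_place_value_def by (rule prod_dvd_prod_subset) auto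

lemma mi_dim_mono: "t \<le> s \<Longrightarrow> mi_dim r t \<le> mi_dim r s"
  using dvd_imp_le[OF mi_place_value_dvd[of "Suc t" "Suc s" r] mi_place_value_pos] Suc_mi_dim[of r]
  by (metis Suc_le_mono)

lemma multi_indices_le: "\<alpha> \<in> multi_indices r s \<Longrightarrow> i \<in> {1..s} \<Longrightarrow> \<alpha> i \<le> r i"
  unfolding multi_indices_def by blast

lemma multi_indices_zero: "\<alpha> \<in> multi_indices r s \<Longrightarrow> i \<notin> {1..s} \<Longrightarrow> \<alpha> i = 0"
  unfolding multi_indices_def by blast

text \<open>The digits below position \<open>t + 1\<close> contribute less than one unit of that position.\<close>

lemma mi_value_less_place_value:
  assumes "\<And>i. i \<in> {1..t} \<Longrightarrow> \<alpha> i \<le> r i"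
  shows "mi_value r t \<alpha> < mi_place_value r (Suc t)"
  using assms
proof (induction t)
  case 0
  then show ?case by (simp add: mi_value_def mi_place_value_pos)
next
  case (Suc t)
  have "mi_value r (Suc t) \<alpha> = mi_value r t \<alpha> + \<alpha> (Suc t) * mi_place_value r (Suc t)"
    by (simp add: mi_value_def)
  also have "\<dots> < mi_place_value r (Suc t) + \<alpha> (Suc t) * mi_place_value r (Suc t)"
    using Suc by simp
  also have "\<dots> \<le> mi_place_value r (Suc t) + r (Suc t) * mi_place_value r (Suc t)"
    using Suc.prems[of "Suc t"] by simp
  also have "\<dots> = mi_place_value r (Suc (Suc t))"
    by (simp add: mi_place_value_Suc algebra_simps)
  finally show ?case .
qed

lemma mi_value_split:
  assumes "t \<le> s"
  shows "mi_value r s \<alpha> = mi_value r t \<alpha> + (\<Sum>i=t+1..s. \<alpha> i * mi_place_value r i)"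
  using assms sum.ub_add_nat[of 1 t "\<lambda>i. \<alpha> i * mi_place_value r i" "s - t"]
  by (simp add: mi_value_def)

lemma mi_value_less:
  assumes a: "\<alpha> \<in> multi_indices r s" and b: "\<beta> \<in> multi_indices r s" and "mi_less \<alpha> \<beta>"
  shows "mi_value r s \<alpha> < mi_value r s \<beta>"
proof -
  obtain k where k: "\<alpha> k < \<beta> k" "\<forall>j>k. \<alpha> j = \<beta> j"
    using assms mi_less_iff[OF finite_diff_mi] by metis
  with multi_indices_zero[OF b, of k] have ks: "k \<in> {1..s}" by force
  then obtain t where t: "k = Suc t" by (cases k) auto
  have "mi_value r k \<alpha> = mi_value r t \<alpha> + \<alpha> k * mi_place_value r k" by (simp add: mi_value_def t)
  also have "\<dots> < mi_place_value r k + \<alpha> k * mi_place_value r k"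
    using mi_value_less_place_value[of t \<alpha> r] multi_indices_le[OF a] ks t by auto
  also have "\<dots> \<le> \<beta> k * mi_place_value r k"
    using k(1) mult_le_mono1[of "Suc (\<alpha> k)" "\<beta> k" "mi_place_value r k"] by simp
  also have "\<dots> \<le> mi_value r k \<beta>" by (simp add: mi_value_def t)
  finally show ?thesis
    using ks k(2) mi_value_split[of k s r \<alpha>] mi_value_split[of k s r \<beta>] by simp
qed

lemma mi_less_iff_mi_value:
  assumes "\<alpha> \<in> multi_indices r s" "\<beta> \<in> multi_indices r s"
  shows "mi_less \<alpha> \<beta> \<longleftrightarrow> mi_value r s \<alpha> < mi_value r s \<beta>"
  using mi_value_less[OF assms] mi_value_less[OF assms(2,1)] mi_less_linear[OF assms]
  by (metis less_irrefl less_asym)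

lemma bij_betw_mi_value: "bij_betw (mi_value r s) (multi_indices r s) {1..mi_dim r s}"
proof -
  have inj: "inj_on (mi_value r s) (multi_indices r s)"
    by (rule inj_onI) (metis mi_value_less mi_less_linear less_irrefl)
  have "mi_value r s \<alpha> \<in> {1..mi_dim r s}" if a: "\<alpha> \<in> multi_indices r s" for \<alpha>
  proof -
    obtain i where i: "\<alpha> i \<noteq> 0" "i \<in> {1..s}"
      using a multi_indices_zero[OF a] unfolding multi_indices_def by blast
    have "0 < \<alpha> i * mi_place_value r i" using i mi_place_value_pos by simp
    also have "\<dots> \<le> mi_value r s \<alpha>"
      unfolding mi_value_def using i by (intro member_le_sum) auto
    finally show ?thesis
      using mi_value_less_place_value[of s \<alpha> r] multi_indices_le[OF a] Suc_mi_dim[of r s] by auto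
  qed
  then have "mi_value r s ` multi_indices r s \<subseteq> {1..mi_dim r s}" by blast
  moreover have "card (mi_value r s ` multi_indices r s) = card {1..mi_dim r s}"
    using card_image[OF inj] by (simp add: card_multi_indices)
  ultimately have "mi_value r s ` multi_indices r s = {1..mi_dim r s}"
    by (intro card_subset_eq) auto
  with inj show ?thesis by (simp add: bij_betw_def)
qed

text \<open>An increasing bijection onto \<open>{1..N}\<close> is the rank function, so it inverts the enumeration.\<close>

lemma mi_nth_mi_value:
  assumes a: "\<alpha> \<in> multi_indices r s"
  shows "mi_nth r s (mi_value r s \<alpha>) = \<alpha>"
proof (rule mi_nth_eq[OF a])
  let ?B = "{\<beta> \<in> multi_indices r s. mi_less \<beta> \<alpha>}"
  have va: "mi_value r s \<alpha> \<in> {1..mi_dim r s}"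
    using a bij_betw_apply[OF bij_betw_mi_value] by blast
  have "mi_value r s ` ?B = {1..<mi_value r s \<alpha>}"
  proof (intro set_eqI iffI)
    fix j assume "j \<in> mi_value r s ` ?B"
    then obtain \<beta> where "\<beta> \<in> multi_indices r s" "mi_less \<beta> \<alpha>" "j = mi_value r s \<beta>" by blast
    then show "j \<in> {1..<mi_value r s \<alpha>}"
      using mi_value_less[OF _ a] bij_betw_apply[OF bij_betw_mi_value] by fastforce
  next
    fix j assume j: "j \<in> {1..<mi_value r s \<alpha>}"
    with va have "j \<in> mi_value r s ` multi_indices r s"
      by (simp add: bij_betw_imp_surj_on[OF bij_betw_mi_value])
    then show "j \<in> mi_value r s ` ?B"
      using j mi_less_iff_mi_value[OF _ a] by auto
  qed
  moreover have "inj_on (mi_value r s) ?B"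
    using bij_betw_imp_inj_on[OF bij_betw_mi_value] by (rule inj_on_subset) blast
  ultimately have "card ?B = mi_value r s \<alpha> - 1"
    using card_image[of "mi_value r s" ?B] by simp
  then show "card ?B + 1 = mi_value r s \<alpha>" using va by auto
qed

lemma mi_nth_in: "j \<in> {1..mi_dim r s} \<Longrightarrow> mi_nth r s j \<in> multi_indices r s"
  using bij_betw_apply[OF bij_betw_mi_nth] .

lemma mi_value_mi_nth:
  assumes "j \<in> {1..mi_dim r s}"
  shows "mi_value r s (mi_nth r s j) = j"
proof -
  have "j \<in> mi_value r s ` multi_indices r s"
    using assms by (simp add: bij_betw_imp_surj_on[OF bij_betw_mi_value])
  then show ?thesis using mi_nth_mi_value by auto
qed

section \<open>Tail degrees\<close>

definition tail_degree :: "(nat \<Rightarrow> nat) \<Rightarrow> nat \<Rightarrow> nat \<Rightarrow> nat \<Rightarrow> nat" where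
  "tail_degree r s t j = (\<Sum>i=t+1..s. mi_nth r s j i)"

text \<open>The tail degree vanishes when all digits of \<open>j\<close> beyond the first \<open>t\<close> are zero, that is, when \<open>j\<close> is
  less than the place value of the next digit.\<close>

lemma tail_degree_eq_0_iff:
  assumes "t \<le> s" "j \<in> {1..mi_dim r s}"
  shows "tail_degree r s t j = 0 \<longleftrightarrow> j \<le> mi_dim r t"
proof
  assume "tail_degree r s t j = 0"
  then have "mi_value r s (mi_nth r s j) = mi_value r t (mi_nth r s j)"
    using mi_value_split[OF assms(1)] by (simp add: tail_degree_def)
  then show "j \<le> mi_dim r t"
    using mi_value_less_place_value[of t "mi_nth r s j" r] multi_indices_le[OF mi_nth_in[OF assms(2)]]
      assms mi_value_mi_nth[OF assms(2)] Suc_mi_dim[of r t] by auto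
next
  assume "j \<le> mi_dim r t"
  with assms have "j \<in> {1..mi_dim r t}" by auto
  then show "tail_degree r s t j = 0"
    using multi_indices_zero[OF mi_nth_in[of j r t]] assms
    by (simp add: tail_degree_def mi_nth_initial_segment)
qed

text \<open>Clearing the first \<open>t\<close> digits of \<open>j\<close> rounds \<open>j\<close> down to a multiple of \<open>N\<^sub>t + 1\<close>, where \<open>N\<^sub>t\<close> is the
  number of multi-indices supported on the first \<open>t\<close> positions.\<close>

lemma tail_degree_eq_mi_abs:
  assumes "t \<le> s" "j \<in> {1..mi_dim r s}" "mi_dim r t < j"
  shows "tail_degree r s t j =
    mi_abs s (mi_nth r s (j div Suc (mi_dim r t) * Suc (mi_dim r t)))"
proof -
  define w where "w = mi_place_value r (Suc t)"
  define \<alpha> where "\<alpha> = mi_nth r s j"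
  define \<beta> where "\<beta> = (\<lambda>i. if i \<le> t then 0 else \<alpha> i)"
  \<comment> \<open>\<open>w\<close> divides \<open>h\<close> and the low digits of \<open>j\<close> amount to less than \<open>w\<close>, so \<open>h\<close> is \<open>j\<close> rounded down.\<close>
  define h where "h = (\<Sum>i=t+1..s. \<alpha> i * mi_place_value r i)"
  have a: "\<alpha> \<in> multi_indices r s" using mi_nth_in[OF assms(2)] by (simp add: \<alpha>_def)
  have zero: "(\<Sum>i=1..t. f (\<beta> i) i) = 0" if "\<And>i. f 0 i = (0::nat)" for f
    using that by (intro sum.neutral) (auto simp: \<beta>_def)
  have split: "(\<Sum>i=1..s. f i) = (\<Sum>i=1..t. f i) + (\<Sum>i=t+1..s. f i)" for f :: "nat \<Rightarrow> nat"
    using assms(1) sum.ub_add_nat[of 1 t f "s - t"] by simp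
  have "\<beta> \<noteq> (\<lambda>_. 0)"
  proof
    assume "\<beta> = (\<lambda>_. 0)"
    then have "\<alpha> i = 0" if "i > t" for i
      using that unfolding \<beta>_def by (metis leD)
    then have "tail_degree r s t j = 0" by (simp add: tail_degree_def \<alpha>_def)
    with assms show False by (simp add: tail_degree_eq_0_iff)
  qed
  then have b: "\<beta> \<in> multi_indices r s"
    using a unfolding multi_indices_def by (auto simp: \<beta>_def)
  have "mi_value r s \<beta> = h"
    unfolding mi_value_def split h_def using zero[of "\<lambda>a i. a * mi_place_value r i"]
    by (simp add: \<beta>_def)
  moreover have "h = j div w * w"
  proof -
    have "j = mi_value r t \<alpha> + h"
      using mi_value_mi_nth[OF assms(2)] mi_value_split[OF assms(1)]
      by (simp add: \<alpha>_def h_def)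
    moreover have "mi_value r t \<alpha> < w"
      using mi_value_less_place_value[of t \<alpha> r] multi_indices_le[OF a] assms(1) by (simp add: w_def)
    moreover have "w dvd h"
      unfolding h_def w_def by (intro dvd_sum dvd_mult mi_place_value_dvd) auto
    ultimately show ?thesis by (auto elim!: dvdE)
  qed
  ultimately have "mi_nth r s (j div w * w) = \<beta>"
    using mi_nth_mi_value[OF b] by simp
  moreover have "mi_abs s \<beta> = tail_degree r s t j"
    unfolding mi_abs_def split tail_degree_def using zero[of "\<lambda>a i. a"]
    by (simp add: \<beta>_def \<alpha>_def)
  ultimately show ?thesis by (simp add: Suc_mi_dim w_def)
qed

section \<open>Tail dilations of the tetrablock\<close>

definition tail_dilation ::
  "(nat \<Rightarrow> nat) \<Rightarrow> nat \<Rightarrow> nat \<Rightarrow> complex \<Rightarrow> (nat \<Rightarrow> complex) \<Rightarrow> nat \<Rightarrow> complex" where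
  "tail_dilation r s t c x =
     (\<lambda>j. if j \<in> {1..mi_dim r s} then c ^ tail_degree r s t j * x j else 0)"

lemma tetra_poly_tail_dilation:
  assumes "t \<le> s"
  shows "tetra_poly r s (tail_dilation r s t c x) z =
    tetra_poly r s x (\<lambda>i. if i \<le> t then z i else c * z i)"
proof -
  have split: "(\<Prod>i=1..s. f i) = (\<Prod>i=1..t. f i) * (\<Prod>i=t+1..s. f i)" for f :: "nat \<Rightarrow> complex"
    using assms prod.ub_add_nat[of 1 t f "s - t"] by simp
  have "(\<Prod>i=1..s. (if i \<le> t then z i else c * z i) ^ mi_nth r s j i) =
      c ^ tail_degree r s t j * (\<Prod>i=1..s. z i ^ mi_nth r s j i)" for j
    unfolding split by (simp add: power_mult_distrib prod.distrib tail_degree_def power_sum)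
  then show ?thesis
    unfolding tetra_poly_def tail_dilation_def by (simp add: mult_ac)
qed

lemma tail_dilation_in_gen_tetrablock:
  assumes "t \<le> s" "x \<in> gen_tetrablock r s" "norm c \<le> 1"
  shows "tail_dilation r s t c x \<in> gen_tetrablock r s"
proof -
  have "(\<lambda>i. if i \<le> t then z i else c * z i) \<in> closed_polydisc s" if "z \<in> closed_polydisc s" for z
    using that assms(3) unfolding closed_polydisc_def cspace_def
    by (auto simp: norm_mult intro: mult_le_one)
  then show ?thesis
    using assms unfolding gen_tetrablock_def
    by (auto simp: tetra_poly_tail_dilation) (auto simp: tail_dilation_def cspace_def)
qed

text \<open>Since \<open>0 ^ 0 = 1\<close>, the coordinates of tail degree \<open>0\<close> survive.\<close>

lemma tail_dilation_zero:
  assumes "t \<le> s" "x \<in> cspace (mi_dim r s)"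
  shows "tail_dilation r s t 0 x = chead (mi_dim r t) x"
  using assms mi_dim_mono[OF assms(1), of r]
  by (auto simp: tail_dilation_def chead_def cspace_def fun_eq_iff tail_degree_eq_0_iff power_0_left)

lemma tail_dilation_one:
  assumes "x \<in> cspace (mi_dim r s)"
  shows "tail_dilation r s t 1 x = x"
  using assms by (auto simp: tail_dilation_def cspace_def fun_eq_iff)

section \<open>The smaller tetrablock as a slice\<close>

lemma cspace_mono: "k \<le> l \<Longrightarrow> cspace k \<subseteq> cspace l"
  unfolding cspace_def by auto

lemma chead_in_cspace: "x \<in> cspace l \<Longrightarrow> chead k x \<in> cspace k"
  unfolding cspace_def chead_def by auto

lemma chead_id: "x \<in> cspace k \<Longrightarrow> chead k x = x"
  unfolding cspace_def chead_def by auto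

lemma cjoin_zero_id: "x \<in> cspace k \<Longrightarrow> cjoin k x (\<lambda>_. 0) = x"
  unfolding cspace_def cjoin_def by auto

lemma tetra_poly_cong:
  assumes "\<And>i. i \<in> {1..s} \<Longrightarrow> z i = z' i"
  shows "tetra_poly r s x z = tetra_poly r s x z'"
proof -
  have "(\<Prod>i=1..s. z i ^ mi_nth r s j i) = (\<Prod>i=1..s. z' i ^ mi_nth r s j i)" for j
    by (rule prod.cong) (auto simp: assms)
  then show ?thesis by (simp add: tetra_poly_def)
qed

text \<open>On the slice only the multi-indices supported on the first \<open>t\<close> positions contribute, and they are
  enumerated first.\<close>

lemma tetra_poly_restrict:
  assumes "t \<le> s" "x \<in> cspace (mi_dim r t)"
  shows "tetra_poly r s x z = tetra_poly r t x z"
proof -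
  let ?f = "\<lambda>s j. (-1) ^ mi_abs s (mi_nth r s j) * x j * (\<Prod>i=1..s. z i ^ mi_nth r s j i)"
  have "sum (?f s) {1..mi_dim r s} = sum (?f s) {1..mi_dim r t}"
    using assms(2) mi_dim_mono[OF assms(1), of r]
    by (intro sum.mono_neutral_right) (auto simp: cspace_def)
  also have "\<dots> = sum (?f t) {1..mi_dim r t}"
  proof (rule sum.cong[OF refl])
    fix j assume j: "j \<in> {1..mi_dim r t}"
    have eq: "mi_nth r s j = mi_nth r t j" using mi_nth_initial_segment[OF assms(1) j] .
    have z: "mi_nth r t j i = 0" if "i \<notin> {1..t}" for i
      using multi_indices_zero[OF mi_nth_in[OF j] that] .
    have "mi_abs s (mi_nth r t j) = mi_abs t (mi_nth r t j)"
      unfolding mi_abs_def using assms(1) z by (intro sum.mono_neutral_right) auto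
    moreover have "(\<Prod>i=1..s. z i ^ mi_nth r t j i) = (\<Prod>i=1..t. z i ^ mi_nth r t j i)"
      using assms(1) z by (intro prod.mono_neutral_right) auto
    ultimately show "?f s j = ?f t j" by (simp add: eq)
  qed
  finally show ?thesis by (simp add: tetra_poly_def)
qed

text \<open>On the slice the polynomial involves the first \<open>t\<close> variables only, so a zero in one
  polydisc gives a zero in the other: set the remaining variables to \<open>0\<close>.\<close>

lemma gen_tetrablock_slice:
  assumes "t \<le> s"
  shows "gen_tetrablock r t = gen_tetrablock r s \<inter> cspace (mi_dim r t)"
proof (intro set_eqI iffI)
  fix x assume x: "x \<in> gen_tetrablock r t"
  then have x': "x \<in> cspace (mi_dim r t)" by (simp add: gen_tetrablock_def)
  have "tetra_poly r s x z \<noteq> 0" if "z \<in> closed_polydisc s" for z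
  proof -
    have "chead t z \<in> closed_polydisc t"
      using that assms by (auto simp: closed_polydisc_def cspace_def chead_def)
    with x have "tetra_poly r t x (chead t z) \<noteq> 0" by (simp add: gen_tetrablock_def)
    moreover have "tetra_poly r t x (chead t z) = tetra_poly r t x z"
      by (rule tetra_poly_cong) (simp add: chead_def)
    ultimately show ?thesis by (simp add: tetra_poly_restrict[OF assms x'])
  qed
  with x' show "x \<in> gen_tetrablock r s \<inter> cspace (mi_dim r t)"
    using cspace_mono[OF mi_dim_mono[OF assms]] by (auto simp: gen_tetrablock_def)
next
  fix x assume x: "x \<in> gen_tetrablock r s \<inter> cspace (mi_dim r t)"
  have "closed_polydisc t \<subseteq> closed_polydisc s"
  proof
    fix z assume z: "z \<in> closed_polydisc t"
    have "norm (z i) \<le> 1" for i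
      using z by (cases "i \<in> {1..t}") (auto simp: closed_polydisc_def cspace_def)
    with z show "z \<in> closed_polydisc s"
      using cspace_mono[OF assms] by (auto simp: closed_polydisc_def)
  qed
  with x show "x \<in> gen_tetrablock r t"
    using tetra_poly_restrict[OF assms] by (auto simp: gen_tetrablock_def)
qed

lemma chead_in_gen_tetrablock:
  assumes "t \<le> s" "x \<in> gen_tetrablock r s"
  shows "chead (mi_dim r t) x \<in> gen_tetrablock r t"
proof -
  have x: "x \<in> cspace (mi_dim r s)" using assms(2) by (simp add: gen_tetrablock_def)
  show ?thesis
    using tail_dilation_in_gen_tetrablock[OF assms, of 0] chead_in_cspace[OF x]
    by (simp add: gen_tetrablock_slice[OF assms(1)] tail_dilation_zero[OF assms(1) x])
qed

section \<open>The tetrablock is a domain\<close>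

text \<open>By Tychonoff, as a product of discs and singletons.\<close>

lemma compact_closed_polydisc: "compact (closed_polydisc k)"
proof -
  let ?B = "\<lambda>i. if i \<in> {1..k} then cball 0 1 else {0 :: complex}"
  have "closed_polydisc k = PiE UNIV ?B"
    unfolding closed_polydisc_def cspace_def PiE_UNIV_domain
    by (auto simp: Pi_iff simp del: atLeastAtMost_iff split: if_splits)
  moreover have "compactin (product_topology (\<lambda>_. euclidean) UNIV) (PiE UNIV ?B)"
    by (simp add: compactin_PiE)
  ultimately show ?thesis by (simp add: euclidean_product_topology)
qed

lemma continuous_on_tetra_poly: "continuous_on UNIV (\<lambda>(x, z). tetra_poly r s x z)"
proof -
  have "continuous_on UNIV (\<lambda>p :: (nat \<Rightarrow> complex) \<times> (nat \<Rightarrow> complex). fst p i)" for i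
    by (intro continuous_on_product_then_coordinatewise[OF continuous_on_fst] continuous_on_id)
  moreover have "continuous_on UNIV (\<lambda>p :: (nat \<Rightarrow> complex) \<times> (nat \<Rightarrow> complex). snd p i)" for i
    by (intro continuous_on_product_then_coordinatewise[OF continuous_on_snd] continuous_on_id)
  ultimately show ?thesis
    unfolding tetra_poly_def case_prod_unfold
    by (intro continuous_on_add continuous_on_sum continuous_on_mult continuous_on_prod
        continuous_on_power continuous_on_const)
qed

text \<open>If the polynomial of \<open>x\<close> has no zero on the compact polydisc, the tube lemma yields a neighborhood of \<open>x\<close>
  whose members have none there either.\<close>

lemma openin_gen_tetrablock: "openin (top_of_set (cspace (mi_dim r s))) (gen_tetrablock r s)"
proof -
  let ?K = "closed_polydisc s"
  let ?U = "{x. \<forall>z\<in>?K. tetra_poly r s x z \<noteq> 0}"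
  let ?W = "{p. (case p of (x, z) \<Rightarrow> tetra_poly r s x z) \<noteq> 0}"
  have W: "open ?W"
    by (rule open_Collect_neq[OF continuous_on_tetra_poly]) simp
  have "\<exists>X. open X \<and> x \<in> X \<and> X \<subseteq> ?U" if "x \<in> ?U" for x
  proof -
    have "{x} \<times> ?K \<subseteq> ?W" using that by auto
    from Elementary_Topology.tube_lemma[OF compact_closed_polydisc W this]
    obtain X where "x \<in> X" "open X" "X \<times> ?K \<subseteq> ?W" by blast
    moreover from this have "X \<subseteq> ?U" by auto
    ultimately show ?thesis by (intro exI[of _ X] conjI)
  qed
  then have "open ?U" by (subst open_subopen) (rule ballI)
  moreover have "gen_tetrablock r s = cspace (mi_dim r s) \<inter> ?U"
    by (auto simp: gen_tetrablock_def)
  ultimately show ?thesis by (simp only: openin_open_Int)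
qed

lemma zero_in_gen_tetrablock: "(\<lambda>_. 0) \<in> gen_tetrablock r s"
  by (simp add: gen_tetrablock_def cspace_def tetra_poly_def)

text \<open>For \<open>t = 0\<close> all multi-indices have positive tail degree, so the dilations with parameter from
  \<open>1\<close> to \<open>0\<close> move every point to the origin within the tetrablock.\<close>

lemma connected_gen_tetrablock: "connected (gen_tetrablock r s)"
proof -
  let ?E = "gen_tetrablock r s"
  define S where "S x = (\<lambda>u :: real. tail_dilation r s 0 (complex_of_real u) x) ` {0..1}" for x
  have E: "x \<in> cspace (mi_dim r s)" if "x \<in> ?E" for x
    using that by (simp add: gen_tetrablock_def)
  have "continuous_on {0..1} (\<lambda>u. tail_dilation r s 0 (complex_of_real u) x)" for x
  proof (rule continuous_on_coordinatewise_then_product)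
    fix j
    show "continuous_on {0..1} (\<lambda>u. tail_dilation r s 0 (complex_of_real u) x j)"
      by (cases "j \<in> {1..mi_dim r s}")
        (auto simp: tail_dilation_def simp del: atLeastAtMost_iff intro!: continuous_intros)
  qed
  then have conn: "connected (S x)" for x
    unfolding S_def by (intro connected_continuous_image connected_Icc)
  have zero: "(\<lambda>_. 0) \<in> S x" if "x \<in> ?E" for x
  proof -
    have "tail_dilation r s 0 (complex_of_real 0) x = (\<lambda>_. 0)"
      using tail_dilation_zero[of 0 s x r] E[OF that]
      by (simp add: chead_def mi_dim_def cspace_def fun_eq_iff)
    then show ?thesis unfolding S_def by (intro rev_image_eqI[of 0]) auto
  qed
  have mem: "x \<in> S x" if "x \<in> ?E" for x
    unfolding S_def using tail_dilation_one[OF E[OF that], of 0]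
    by (intro rev_image_eqI[of 1]) auto
  have sub: "S x \<subseteq> ?E" if "x \<in> ?E" for x
    unfolding S_def using that tail_dilation_in_gen_tetrablock[of 0 s x r] by auto
  have union: "\<Union> (S ` ?E) = ?E" using mem sub by blast
  have "connected (\<Union> (S ` ?E))"
  proof (rule connected_Union)
    have "(\<lambda>_. 0) \<in> \<Inter> (S ` ?E)" using zero by blast
    then show "\<Inter> (S ` ?E) \<noteq> {}" by (intro notI) (simp only: empty_iff)
    show "connected A" if "A \<in> S ` ?E" for A
      using that conn by (elim imageE) simp
  qed
  then show ?thesis by (simp only: union)
qed

lemma cdomain_gen_tetrablock: "cdomain (mi_dim r s) (gen_tetrablock r s)"
  unfolding cdomain_def
  using zero_in_gen_tetrablock
  by (intro conjI openin_gen_tetrablock connected_gen_tetrablock) (metis empty_iff)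

section \<open>The retraction and the fibers\<close>

lemma cholomorphic_coordinate:
  assumes "i \<in> {1..k}" "\<And>x. x \<in> D \<Longrightarrow> f x = x i"
  shows "cholomorphic k D f"
  unfolding cholomorphic_def
proof (intro ballI exI)
  fix x assume x: "x \<in> D"
  show "((\<lambda>y. (f y - f x - (\<Sum>j=1..k. (if j = i then 1 else 0) * (y j - x j))) /
          complex_of_real (L2_set (\<lambda>j. norm (y j - x j)) {1..k})) \<longlongrightarrow> 0) (at x within D)"
  proof (rule tendsto_eventually)
    have "f y - f x - (\<Sum>j=1..k. (if j = i then 1 else 0) * (y j - x j)) = 0" if "y \<in> D" for y
    proof -
      have "(\<Sum>j=1..k. (if j = i then 1 else 0) * (y j - x j)) = (\<Sum>j=1..k. if j = i then y j - x j else 0)"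
        by (rule sum.cong) auto
      also have "\<dots> = y i - x i" using assms(1) by simp
      finally show ?thesis using assms(2) x that by simp
    qed
    then show "\<forall>\<^sub>F y in at x within D.
        (f y - f x - (\<Sum>j=1..k. (if j = i then 1 else 0) * (y j - x j))) /
          complex_of_real (L2_set (\<lambda>j. norm (y j - x j)) {1..k}) = 0"
      by (auto simp: eventually_at_filter)
  qed
qed

lemma cholomorphic_zero:
  assumes "\<And>x. x \<in> D \<Longrightarrow> f x = 0"
  shows "cholomorphic k D f"
  unfolding cholomorphic_def
proof (intro ballI exI)
  fix x assume "x \<in> D"
  with assms show "((\<lambda>y. (f y - f x - (\<Sum>j=1..k. 0 * (y j - x j))) /
          complex_of_real (L2_set (\<lambda>j. norm (y j - x j)) {1..k})) \<longlongrightarrow> 0) (at x within D)"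
    by (intro tendsto_eventually) (auto simp: eventually_at_filter)
qed

lemma analytic_retract_gen_tetrablock:
  assumes "t \<le> s"
  shows "analytic_retract (mi_dim r t) (gen_tetrablock r t) (mi_dim r s) (gen_tetrablock r s)"
proof -
  have G: "x \<in> cspace (mi_dim r t)" if "x \<in> gen_tetrablock r t" for x
    using that by (simp add: gen_tetrablock_def)
  have "cholomorphic (mi_dim r t) (gen_tetrablock r t) (\<lambda>x. x i)" for i
  proof (cases "i \<in> {1..mi_dim r t}")
    case True
    then show ?thesis by (rule cholomorphic_coordinate) simp
  next
    case False
    then show ?thesis using G by (intro cholomorphic_zero) (auto simp: cspace_def)
  qed
  then have "cholomorphic_map (mi_dim r t) (gen_tetrablock r t) (mi_dim r s) (gen_tetrablock r s) (\<lambda>x. x)"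
    using gen_tetrablock_slice[OF assms] by (auto simp: cholomorphic_map_def)
  moreover have "cholomorphic_map (mi_dim r s) (gen_tetrablock r s) (mi_dim r t) (gen_tetrablock r t)
      (chead (mi_dim r t))"
    unfolding cholomorphic_map_def
  proof (intro conjI ballI)
    fix i assume "i \<in> {1..mi_dim r t}"
    then show "cholomorphic (mi_dim r s) (gen_tetrablock r s) (\<lambda>x. chead (mi_dim r t) x i)"
      using mi_dim_mono[OF assms, of r]
      by (intro cholomorphic_coordinate[of i]) (auto simp: chead_def)
  qed (use chead_in_gen_tetrablock[OF assms] in blast)
  ultimately show ?thesis
    unfolding analytic_retract_def using cdomain_gen_tetrablock chead_id[OF G] by blast
qed

lemma length_concat_replicate:
  "length (concat (map (\<lambda>k. replicate n (f k)) [1..<Suc q])) = n * q"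
  by (induction q) auto

lemma nth_concat_replicate:
  assumes "i < n * q"
  shows "concat (map (\<lambda>k. replicate n (f k)) [1..<Suc q]) ! i = f (Suc (i div n))"
  using assms
proof (induction q)
  case (Suc q)
  show ?case
  proof (cases "i < n * q")
    case True
    with Suc show ?thesis
      using length_concat_replicate[of n f q] by (simp add: nth_append)
  next
    case False
    with Suc.prems have "i div n = q"
      by (intro div_nat_eqI) (auto simp: algebra_simps)
    with False Suc.prems show ?thesis
      using length_concat_replicate[of n f q] by (simp add: nth_append)
  qed
qed simp

text \<open>The first \<open>N\<^sub>t\<close> coordinates have tail degree \<open>0\<close>, so a tail dilation fixes them. In the hypothesis on
  \<open>m\<close>, list positions start at \<open>0\<close>, and coordinate \<open>i\<close> of \<open>x''\<close> is coordinate \<open>N\<^sub>t + i\<close> of the joined vector.\<close>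

lemma cjoin_m_dilation:
  assumes "t \<le> s" "x' \<in> cspace (mi_dim r t)" "length m = mi_dim r s - mi_dim r t"
    and m: "\<And>i. i \<in> {1..length m} \<Longrightarrow> m ! (i - 1) = tail_degree r s t (mi_dim r t + i)"
  shows "cjoin (mi_dim r t) x' (m_dilation m c x'') =
    tail_dilation r s t c (cjoin (mi_dim r t) x' x'')"
proof
  fix j
  have N: "mi_dim r t \<le> mi_dim r s" using mi_dim_mono[OF assms(1)] .
  show "cjoin (mi_dim r t) x' (m_dilation m c x'') j =
      tail_dilation r s t c (cjoin (mi_dim r t) x' x'') j"
  proof (cases "j \<le> mi_dim r t")
    case True
    show ?thesis
    proof (cases "j = 0")
      case True
      with assms(2) show ?thesis by (simp add: cjoin_def tail_dilation_def cspace_def)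
    next
      case False
      with True N assms(1) have "tail_degree r s t j = 0"
        by (simp add: tail_degree_eq_0_iff)
      with True False N show ?thesis by (simp add: cjoin_def tail_dilation_def)
    qed
  next
    case False
    with N assms(3) m[of "j - mi_dim r t"] show ?thesis
      by (auto simp: cjoin_def tail_dilation_def m_dilation_def)
  qed
qed

lemma hartogs_over_gen_tetrablock:
  assumes "t \<le> s" "length m = mi_dim r s - mi_dim r t"
    and "\<And>i. i \<in> {1..length m} \<Longrightarrow> m ! (i - 1) = tail_degree r s t (mi_dim r t + i)"
  shows "hartogs_over (mi_dim r t) (mi_dim r s - mi_dim r t) m
    (gen_tetrablock r s) (gen_tetrablock r t)"
proof -
  let ?k = "mi_dim r t"
  have slice: "gen_tetrablock r t = gen_tetrablock r s \<inter> cspace ?k"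
    using gen_tetrablock_slice[OF assms(1)] .
  have emb: "{cjoin ?k x' (\<lambda>_. 0) |x'. x' \<in> A} = A" if "A \<subseteq> cspace ?k" for A
    using that cjoin_zero_id by force
  have "gen_tetrablock r s \<inter> {cjoin ?k x' (\<lambda>_. 0) |x'. x' \<in> cspace ?k} =
      {cjoin ?k x' (\<lambda>_. 0) |x'. x' \<in> gen_tetrablock r t}"
    using emb[of "cspace ?k"] emb[of "gen_tetrablock r t"] slice by simp
  moreover have "chead ?k ` gen_tetrablock r s = gen_tetrablock r t"
  proof
    show "chead ?k ` gen_tetrablock r s \<subseteq> gen_tetrablock r t"
      using chead_in_gen_tetrablock[OF assms(1)] by blast
    show "gen_tetrablock r t \<subseteq> chead ?k ` gen_tetrablock r s"
    proof
      fix x assume "x \<in> gen_tetrablock r t"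
      then show "x \<in> chead ?k ` gen_tetrablock r s"
        using chead_id[of x ?k] by (intro image_eqI[of x _ x]) (simp_all add: slice)
    qed
  qed
  moreover have "m_balanced (mi_dim r s - ?k) m
      {x'' \<in> cspace (mi_dim r s - ?k). cjoin ?k x' x'' \<in> gen_tetrablock r s}"
    if "x' \<in> gen_tetrablock r t" for x'
  proof -
    have x': "x' \<in> cspace ?k" using that by (simp add: gen_tetrablock_def)
    have "m_dilation m c x'' \<in> cspace (mi_dim r s - ?k)" for c x''
      by (simp add: m_dilation_def cspace_def assms(2))
    moreover have "cjoin ?k x' (m_dilation m c x'') \<in> gen_tetrablock r s"
      if "cjoin ?k x' x'' \<in> gen_tetrablock r s" "norm c \<le> 1" for c x''
      using tail_dilation_in_gen_tetrablock[OF assms(1) that]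
      by (simp only: cjoin_m_dilation[OF assms(1) x' assms(2,3)])
    ultimately show ?thesis unfolding m_balanced_def using assms(2) by blast
  qed
  ultimately show ?thesis unfolding hartogs_over_def by blast
qed

theorem theorem3p7:
  fixes n s s' N N' N'' M :: nat and r :: "nat \<Rightarrow> nat" and m :: "nat list"
  assumes "n \<ge> 2" and "1 \<le> s" and "s \<le> n"
    and "\<forall>j\<in>{1..s}. r j \<ge> 1" and "(\<Sum>j=1..s. r j) = n"
    and "1 \<le> s'" and "s' \<le> s"
    and "N = (\<Prod>j=1..s. r j + 1) - 1"
    and "N' = (\<Prod>j=1..s'. r j + 1) - 1"
    and "N'' = N - N'"
    and "M = (\<Prod>j=s'+1..s. r j + 1) - 1"
    and "m = concat (map (\<lambda>k. replicate (N' + 1) (mi_abs s (mi_nth r s (k * (N' + 1))))) [1..<M + 1])"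
  shows "(\<lambda>x'. cjoin N' x' (\<lambda>_. 0)) \<in> gen_tetrablock r s' \<rightarrow> gen_tetrablock r s
       \<and> chead N' \<in> gen_tetrablock r s \<rightarrow> gen_tetrablock r s'
       \<and> analytic_retract N' (gen_tetrablock r s') N (gen_tetrablock r s)
       \<and> hartogs_over N' N'' m (gen_tetrablock r s) (gen_tetrablock r s')"
proof -
  have N: "N = mi_dim r s" and N': "N' = mi_dim r s'"
    using assms by (simp_all add: mi_dim_def)
  have "Suc (mi_dim r s) = Suc N' * (\<Prod>j=s'+1..s. r j + 1)"
    using \<open>s' \<le> s\<close> prod.ub_add_nat[of 1 s' "\<lambda>j. r j + 1" "s - s'"]
    by (simp add: N' Suc_mi_dim mi_place_value_def atLeastLessThanSuc_atLeastAtMost)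
  moreover have "(\<Prod>j=s'+1..s. r j + 1) = M + 1"
    using assms(11) prod_pos[of "{s'+1..s}" "\<lambda>j. r j + 1"] by simp
  ultimately have dim: "mi_dim r s - mi_dim r s' = Suc N' * M" and N'': "N'' = Suc N' * M"
    using assms(10) by (simp_all add: N N')
  let ?f = "\<lambda>k. mi_abs s (mi_nth r s (k * Suc N'))"
  have m: "m = concat (map (\<lambda>k. replicate (Suc N') (?f k)) [1..<Suc M])"
    by (simp only: assms(12) Suc_eq_plus1)
  have len: "length m = Suc N' * M"
    unfolding m by (rule length_concat_replicate)
  have "m ! (i - 1) = tail_degree r s s' (mi_dim r s' + i)" if i: "i \<in> {1..length m}" for i
  proof -
    \<comment> \<open>The entry \<open>i - 1\<close> of \<open>m\<close>, counted from \<open>0\<close>, lies in block \<open>(i - 1) div (N' + 1) + 1\<close>.\<close>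
    have "(N' + i) div Suc N' = Suc ((i - 1) div Suc N')"
    proof -
      have "N' + i = Suc N' + (i - 1)" using i by simp
      then show ?thesis by (simp only: div_add_self1)
    qed
    moreover have "m ! (i - 1) = ?f (Suc ((i - 1) div Suc N'))"
      unfolding m by (rule nth_concat_replicate) (use i len in auto)
    moreover have "mi_dim r s' + i \<in> {1..mi_dim r s}" "mi_dim r s' < mi_dim r s' + i"
      using i len dim by auto
    ultimately show ?thesis
      using tail_degree_eq_mi_abs[OF \<open>s' \<le> s\<close>, of "mi_dim r s' + i" r] by (simp only: N')
  qed
  then have "hartogs_over N' N'' m (gen_tetrablock r s) (gen_tetrablock r s')"
    using hartogs_over_gen_tetrablock[of s' s m r] \<open>s' \<le> s\<close> len dim by (simp add: N' N'')
  moreover have "(\<lambda>x'. cjoin N' x' (\<lambda>_. 0)) \<in> gen_tetrablock r s' \<rightarrow> gen_tetrablock r s"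
    using gen_tetrablock_slice[OF \<open>s' \<le> s\<close>] by (auto simp: N' cjoin_zero_id)
  moreover have "chead N' \<in> gen_tetrablock r s \<rightarrow> gen_tetrablock r s'"
    using chead_in_gen_tetrablock[OF \<open>s' \<le> s\<close>] by (auto simp: N')
  ultimately show ?thesis
    using analytic_retract_gen_tetrablock[OF \<open>s' \<le> s\<close>] by (simp add: N N')
qed

end
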